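(* Let $P, Q$ be nonzero real numbers with $\Delta := P^2 - 4Q > 0$, and let $(U_n)_{n\in\mathbb{Z}}$ and $\beta$ be as in the context. Let $(a_n)_{n \geq 1}$ be a strictly increasing sequence of positive integers. Then both series below converge and $$\sum_{n = 1}^{+\infty} (-1)^n \frac{\beta^{a_n}}{U_{a_n}} = - \sum_{n = 1}^{+\infty} Q^{a_{2n - 1}} \frac{U_{a_{2n} - a_{2n - 1}}}{U_{a_{2n}} U_{a_{2n - 1}}}.$$
   Context: $P, Q$ are fixed nonzero real numbers with $\Delta := P^2 - 4Q > 0$. $\alpha$ and $\beta$ denote the two real roots of $X^2 - PX + Q = 0$, labelled so that $|\alpha| > |\beta|$ (the absolute values are distinct because $P \neq 0$ and $\Delta > 0$). The Lucas sequence of the first kind $(U_n)_{n \in \mathbb{Z}}$ is defined by $U_0 = 0$, $U_1 = 1$ and $U_{n+2} = P U_{n+1} - Q U_n$ for all $n \in \mathbb{Z}$; equivalently $U_n = \frac{\alpha^n - \beta^n}{\alpha - \beta}$. *)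

theory Defs
  imports Complex_Main
begin

definition lucas_first_kind :: "real \<Rightarrow> real \<Rightarrow> (int \<Rightarrow> real) \<Rightarrow> bool" where
  "lucas_first_kind P Q U \<longleftrightarrow>
     U 0 = 0 \<and> U 1 = 1 \<and> (\<forall>n::int. U (n + 2) = P * U (n + 1) - Q * U n)"

definition ordered_roots :: "real \<Rightarrow> real \<Rightarrow> real \<Rightarrow> real \<Rightarrow> bool" where
  "ordered_roots P Q \<alpha> \<beta> \<longleftrightarrow>
     {x::real. x\<^sup>2 - P * x + Q = 0} = {\<alpha>, \<beta>} \<and> \<bar>\<alpha>\<bar> > \<bar>\<beta>\<bar>"

text \<open>
  The two predicates determine their arguments, so quantifying universally over them is the same as
  speaking of the roots and of the Lucas sequence.
\<close>

lemma ordered_roots_iff: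
  fixes P Q :: real
  assumes "P \<noteq> 0" "P\<^sup>2 - 4 * Q > 0"
  shows "ordered_roots P Q \<alpha> \<beta> \<longleftrightarrow>
    \<alpha> = (P + sgn P * sqrt (P\<^sup>2 - 4 * Q)) / 2 \<and> \<beta> = (P - sgn P * sqrt (P\<^sup>2 - 4 * Q)) / 2"
proof -
  define d where "d = sgn P * sqrt (P\<^sup>2 - 4 * Q)"
  have d2: "d * d = P * P - 4 * Q"
    using assms by (auto simp: d_def power2_eq_square sgn_if)
  define a where "a = (P + d) / 2"
  define b where "b = (P - d) / 2"
  have "x\<^sup>2 - P * x + Q = (x - a) * (x - b)" for x
    using d2 by (simp add: a_def b_def power2_eq_square field_simps)
  then have roots: "{x. x\<^sup>2 - P * x + Q = 0} = {a, b}"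
    by auto
  have "\<bar>a\<bar> > \<bar>b\<bar>"
  proof (cases "P > 0")
    case True
    then have "d > 0" using assms by (simp add: d_def)
    then show ?thesis using True by (simp add: a_def b_def abs_if field_simps)
  next
    case False
    then have "P < 0" using assms by simp
    moreover from this have "d < 0" using assms by (simp add: d_def)
    ultimately show ?thesis by (simp add: a_def b_def abs_if field_simps)
  qed
  then have "ordered_roots P Q \<alpha> \<beta> \<longleftrightarrow> \<alpha> = a \<and> \<beta> = b"
    unfolding ordered_roots_def roots by (auto simp: doubleton_eq_iff)
  then show ?thesis by (simp add: a_def b_def d_def)
qed

lemma lucas_first_kind_iff:
  fixes P Q :: real
  assumes "Q \<noteq> 0" and "ordered_roots P Q \<alpha> \<beta>"
  shows "lucas_first_kind P Q U \<longleftrightarrow> U = (\<lambda>n. (\<alpha> powi n - \<beta> powi n) / (\<alpha> - \<beta>))"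
proof -
  define V where "V = (\<lambda>n::int. (\<alpha> powi n - \<beta> powi n) / (\<alpha> - \<beta>))"
  have "\<alpha> \<in> {x. x\<^sup>2 - P * x + Q = 0}" "\<beta> \<in> {x. x\<^sup>2 - P * x + Q = 0}"
    using assms(2) unfolding ordered_roots_def by auto
  then have a: "\<alpha>\<^sup>2 = P * \<alpha> - Q" and b: "\<beta>\<^sup>2 = P * \<beta> - Q" by auto
  have ne: "\<alpha> \<noteq> \<beta>" using assms(2) unfolding ordered_roots_def by auto
  have nz: "\<alpha> \<noteq> 0" "\<beta> \<noteq> 0" using a b assms(1) by auto
  have rec: "x powi (n + 2) = P * x powi (n + 1) - Q * x powi n"
    if "x \<noteq> 0" "x\<^sup>2 = P * x - Q" for x :: real and n :: int
  proof -
    have "x powi (n + 2) = x powi n * x\<^sup>2" "x powi (n + 1) = x powi n * x"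
      using that(1) by (simp_all add: power_int_add)
    then show ?thesis by (simp add: that(2) algebra_simps)
  qed
  have V: "lucas_first_kind P Q V"
    unfolding lucas_first_kind_def
  proof (intro conjI allI)
    fix n
    show "V (n + 2) = P * V (n + 1) - Q * V n"
      unfolding V_def rec[OF nz(1) a] rec[OF nz(2) b]
      by (simp add: algebra_simps add_divide_distrib diff_divide_distrib)
  qed (use ne in \<open>simp_all add: V_def\<close>)
  have "U = V" if U: "lucas_first_kind P Q U"
  proof
    fix n
    have up: "U (int k) = V (int k) \<and> U (int k + 1) = V (int k + 1)" for k
    proof (induction k)
      case 0
      then show ?case using U V by (simp add: lucas_first_kind_def)
    next
      case (Suc k)
      have "U (int k + 2) = V (int k + 2)"
        using U V Suc by (simp add: lucas_first_kind_def)
      then show ?case using Suc by (simp add: add.commute)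
    qed
    have down: "U (- int k) = V (- int k) \<and> U (- int k + 1) = V (- int k + 1)" for k
    proof (induction k)
      case 0
      then show ?case using U V by (simp add: lucas_first_kind_def)
    next
      case (Suc k)
      define m where "m = - int (Suc k)"
      have m: "- int k = m + 1" "- int k + 1 = m + 2" by (simp_all add: m_def)
      have "Q * U m = P * U (m + 1) - U (m + 2)" "Q * V m = P * V (m + 1) - V (m + 2)"
        using U V by (simp_all add: lucas_first_kind_def)
      then have "Q * U m = Q * V m" using Suc unfolding m by (simp add: add.commute)
      then have "U m = V m" using assms(1) by simp
      then show ?case using Suc unfolding m m_def[symmetric] by simp
    qed
    show "U n = V n" using up down by (metis int_cases2)
  qed
  then show ?thesis using V unfolding V_def by blast
qed

end

theory Submission
  imports Defs
begin

text \<open>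
  Put $q = \beta/\alpha$, so that $|q| < 1$. As $U_m (\alpha - \beta) = \alpha^m (1 - q^m)$, the terms
  $\beta^m / U_m$ are $O(|q|^m)$ and the alternating series converges absolutely. Its terms may
  therefore be grouped in consecutive pairs, and the identity
  $U_l = \alpha^m U_{l-m} + \beta^{l-m} U_m$ turns each pair into
  $\beta^l / U_l - \beta^m / U_m = - Q^m U_{l-m} / (U_l U_m)$.
\<close>

lemma ordered_roots_prod:
  assumes "ordered_roots P Q \<alpha> \<beta>"
  shows "\<alpha> * \<beta> = Q"
proof -
  have "\<alpha> \<in> {x. x\<^sup>2 - P * x + Q = 0}" "\<beta> \<in> {x. x\<^sup>2 - P * x + Q = 0}" and ne: "\<alpha> \<noteq> \<beta>"
    using assms unfolding ordered_roots_def by auto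
  then have a: "\<alpha>\<^sup>2 - P * \<alpha> + Q = 0" and b: "\<beta>\<^sup>2 - P * \<beta> + Q = 0" by auto
  then have "(\<alpha> - \<beta>) * (\<alpha> * \<beta> - Q) = 0"
    by algebra
  then show ?thesis using ne by simp
qed

text \<open>Positive powers preserve the strict inequality between absolute values. Hence no Lucas
  number of positive index vanishes, and denominators can be cleared later.\<close>

lemma power_diff_ne_0:
  fixes \<alpha> \<beta> :: real
  assumes "\<bar>\<beta>\<bar> < \<bar>\<alpha>\<bar>" "m > 0"
  shows "\<alpha> ^ m - \<beta> ^ m \<noteq> 0"
proof -
  have "\<bar>\<beta> ^ m\<bar> < \<bar>\<alpha> ^ m\<bar>"
    using assms by (simp add: power_abs power_strict_mono)
  then show ?thesis by auto
qed

lemma abs_power_div_lucas_le: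
  fixes \<alpha> \<beta> :: real
  assumes ab: "\<bar>\<beta>\<bar> < \<bar>\<alpha>\<bar>" and m: "m > 0"
  shows "\<bar>\<beta> ^ m / ((\<alpha> ^ m - \<beta> ^ m) / (\<alpha> - \<beta>))\<bar>
    \<le> \<bar>\<alpha> - \<beta>\<bar> / (1 - \<bar>\<beta> / \<alpha>\<bar>) * \<bar>\<beta> / \<alpha>\<bar> ^ m"
proof -
  define q where "q = \<beta> / \<alpha>"
  have \<alpha>: "\<alpha> \<noteq> 0" and q: "\<bar>q\<bar> < 1"
    using ab by (auto simp: q_def)
  have \<beta>: "\<beta> = q * \<alpha>" using \<alpha> by (simp add: q_def)
  \<comment> \<open>Here \<open>m > 0\<close> enters: it keeps \<open>1 - q ^ m\<close> away from 0
    by \<open>1 - \<bar>q\<bar>\<close>, a bound that does not depend on \<open>m\<close>.\<close>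
  have "\<bar>q\<bar> ^ m \<le> \<bar>q\<bar> ^ 1"
    by (rule power_decreasing) (use q m in auto)
  then have "1 - \<bar>q\<bar> \<le> \<bar>1 - q ^ m\<bar>"
    using abs_ge_self[of "1 - q ^ m"] abs_ge_self[of "q ^ m"] by (simp add: power_abs)
  then have "\<bar>\<alpha> - \<beta>\<bar> * \<bar>q\<bar> ^ m / \<bar>1 - q ^ m\<bar> \<le> \<bar>\<alpha> - \<beta>\<bar> * \<bar>q\<bar> ^ m / (1 - \<bar>q\<bar>)"
    using q by (intro divide_left_mono) auto
  moreover have "\<beta> ^ m / ((\<alpha> ^ m - \<beta> ^ m) / (\<alpha> - \<beta>)) = (\<alpha> - \<beta>) * q ^ m / (1 - q ^ m)"
  proof -
    have "\<alpha> ^ m - \<beta> ^ m = \<alpha> ^ m * (1 - q ^ m)" "\<beta> ^ m = \<alpha> ^ m * q ^ m"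
      by (simp_all add: \<beta> power_mult_distrib algebra_simps)
    then show ?thesis using \<alpha> by simp
  qed
  ultimately show ?thesis
    unfolding q_def[symmetric] by (simp add: abs_mult power_abs)
qed

lemma power_div_lucas_diff:
  fixes \<alpha> \<beta> :: real
  defines "V \<equiv> \<lambda>n::int. (\<alpha> powi n - \<beta> powi n) / (\<alpha> - \<beta>)"
  assumes ab: "\<bar>\<beta>\<bar> < \<bar>\<alpha>\<bar>" and m: "0 < m" "m < l"
  shows "\<beta> ^ l / V (int l) - \<beta> ^ m / V (int m) =
    - ((\<alpha> * \<beta>) ^ m * (V (int l - int m) / (V (int l) * V (int m))))"
proof -
  obtain k where l: "l = m + k" using m(2) less_imp_add_positive by blast
  have ne: "\<alpha> - \<beta> \<noteq> 0" using ab by auto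
  have nz: "V (int l) \<noteq> 0" "V (int m) \<noteq> 0"
    using power_diff_ne_0[OF ab] m ne by (auto simp: V_def)
  have V: "V (int i) = (\<alpha> ^ i - \<beta> ^ i) / (\<alpha> - \<beta>)" for i
    by (simp add: V_def)
  \<comment> \<open>With \<open>l = m + k\<close>, the mixed products
    \<open>\<alpha> ^ m * \<beta> ^ k\<close> cancel on the right.\<close>
  have "V (int l) = \<alpha> ^ m * V (int k) + \<beta> ^ k * V (int m)"
    unfolding V times_divide_eq_right add_divide_distrib[symmetric] l
    by (simp add: power_add algebra_simps)
  \<comment> \<open>Multiply the previous identity by \<open>\<beta> ^ m\<close>: the term
    \<open>\<beta> ^ l * V (int m)\<close> appears and cancels. This is the numerator over the
    common denominator.\<close>
  then have "\<beta> ^ l * V (int m) - \<beta> ^ m * V (int l) = - ((\<alpha> * \<beta>) ^ m * V (int k))"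
    by (simp add: l power_add power_mult_distrib algebra_simps)
  moreover have "int l - int m = int k" by (simp add: l)
  ultimately show ?thesis
    by (simp only: diff_frac_eq[OF nz] minus_divide_left times_divide_eq_right)
qed

text \<open>Each step raises the value by at least one. This turns decay in \<open>a (n + 1)\<close>
  into decay in \<open>n\<close>, as the comparison with a geometric series requires.\<close>

lemma strict_mono_on_pos_ge:
  fixes a :: "nat \<Rightarrow> nat"
  assumes "strict_mono_on {1..} a"
  shows "n \<le> a (n + 1)"
proof (induction n)
  case (Suc n)
  have "a (n + 1) < a (Suc n + 1)"
    using assms by (rule strict_mono_onD) auto
  then show ?case using Suc by simp
qed simp

theorem theorem3p1:
  fixes P Q \<alpha> \<beta> :: real
    and U :: "int \<Rightarrow> real"
    and a :: "nat \<Rightarrow> nat"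
  assumes "P \<noteq> 0" and "Q \<noteq> 0" and "P\<^sup>2 - 4 * Q > 0"
    and "ordered_roots P Q \<alpha> \<beta>"
    and "lucas_first_kind P Q U"
    and "strict_mono_on {1..} a"
    and "\<And>n. n \<ge> 1 \<Longrightarrow> a n > 0"
  shows "summable (\<lambda>n. (- 1) ^ (n + 1) * (\<beta> ^ a (n + 1) / U (int (a (n + 1)))))
       \<and> summable (\<lambda>n. Q ^ a (2 * (n + 1) - 1) *
            (U (int (a (2 * (n + 1))) - int (a (2 * (n + 1) - 1))) /
              (U (int (a (2 * (n + 1)))) * U (int (a (2 * (n + 1) - 1))))))
       \<and> (\<Sum>n. (- 1) ^ (n + 1) * (\<beta> ^ a (n + 1) / U (int (a (n + 1))))) =
           - (\<Sum>n. Q ^ a (2 * (n + 1) - 1) *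
            (U (int (a (2 * (n + 1))) - int (a (2 * (n + 1) - 1))) /
              (U (int (a (2 * (n + 1)))) * U (int (a (2 * (n + 1) - 1))))))"
proof -
  define f where "f n = (- 1) ^ (n + 1) * (\<beta> ^ a (n + 1) / U (int (a (n + 1))))" for n
  define g where "g n = Q ^ a (2 * (n + 1) - 1) *
            (U (int (a (2 * (n + 1))) - int (a (2 * (n + 1) - 1))) /
              (U (int (a (2 * (n + 1)))) * U (int (a (2 * (n + 1) - 1)))))" for n
  define r where "r = \<bar>\<beta> / \<alpha>\<bar>"
  have ab: "\<bar>\<beta>\<bar> < \<bar>\<alpha>\<bar>"
    using assms(4) by (simp add: ordered_roots_def)
  have U: "U = (\<lambda>n. (\<alpha> powi n - \<beta> powi n) / (\<alpha> - \<beta>))"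
    using lucas_first_kind_iff[OF assms(2,4)] assms(5) by simp
  have Q: "\<alpha> * \<beta> = Q"
    using ordered_roots_prod[OF assms(4)] .
  have r: "0 \<le> r" "r < 1" using ab by (auto simp: r_def)
  have "summable f"
  proof (rule summable_comparison_test')
    show "summable (\<lambda>n. \<bar>\<alpha> - \<beta>\<bar> / (1 - r) * r ^ n)"
      using r by (intro summable_mult summable_geometric) auto
  next
    fix n :: nat
    have "norm (f n) = \<bar>\<beta> ^ a (n + 1) / ((\<alpha> ^ a (n + 1) - \<beta> ^ a (n + 1)) / (\<alpha> - \<beta>))\<bar>"
      by (simp add: f_def U abs_mult power_abs)
    also have "\<dots> \<le> \<bar>\<alpha> - \<beta>\<bar> / (1 - r) * r ^ a (n + 1)"
      unfolding r_def by (rule abs_power_div_lucas_le[OF ab]) (simp add: assms(7))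
    also have "\<dots> \<le> \<bar>\<alpha> - \<beta>\<bar> / (1 - r) * r ^ n"
      using r strict_mono_on_pos_ge[OF assms(6), of n]
      by (intro mult_left_mono power_decreasing) auto
    finally show "norm (f n) \<le> \<bar>\<alpha> - \<beta>\<bar> / (1 - r) * r ^ n" .
  qed
  \<comment> \<open>Grouping a convergent series into blocks of two keeps its sum, so the
    convergence of \<open>g\<close> comes out along with its value.\<close>
  then have "(\<lambda>n. sum f {n * 2..<n * 2 + 2}) sums suminf f"
    by (intro sums_group summable_sums) auto
  moreover have "sum f {n * 2..<n * 2 + 2} = - g n" for n
  proof -
    define m where "m = a (2 * (n + 1) - 1)"
    define l where "l = a (2 * (n + 1))"
    have ml: "0 < m" "m < l"
      using assms(7) strict_mono_onD[OF assms(6), of "2 * (n + 1) - 1" "2 * (n + 1)"]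
      by (auto simp: m_def l_def)
    have "sum f {n * 2..<n * 2 + 2} = f (2 * n) + f (2 * n + 1)"
      by (simp add: numeral_2_eq_2 mult.commute)
    \<comment> \<open>As \<open>f\<close> counts from 0, \<open>f (2 * n)\<close> belongs to the odd
      index \<open>2 * n + 1\<close> and carries the minus sign; \<open>f (2 * n + 1)\<close>
      belongs to the next even index.\<close>
    also have "\<dots> = \<beta> ^ l / U (int l) - \<beta> ^ m / U (int m)"
      by (simp add: f_def m_def l_def)
    also have "\<dots> = - (Q ^ m * (U (int l - int m) / (U (int l) * U (int m))))"
      using power_div_lucas_diff[OF ab ml] by (simp only: U Q)
    finally show ?thesis by (simp only: g_def m_def l_def)
  qed
  ultimately have "g sums (- suminf f)"
    using sums_minus by fastforce
  then have "summable f \<and> summable g \<and> suminf f = - suminf g"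
    using \<open>summable f\<close> by (auto simp: sums_iff)
  then show ?thesis unfolding f_def g_def .
qed

end
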